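(* For every integer $r\ge 1$ there exists a graph $G$ of order $n=7r$ such that $\operatorname{th}_{\gamma_P}^{\times}(G)\cdot\operatorname{th}_{\gamma_P}^{\times}(\overline G)=24r=\frac{24n}{7}$. Consequently, if $M(n)$ denotes the maximum of $\operatorname{th}_{\gamma_P}^{\times}(G)\cdot\operatorname{th}_{\gamma_P}^{\times}(\overline G)$ over all graphs $G$ of order $n$, then $M(n)=\Theta(n)$.
   Context: Graphs are finite, simple, undirected, with nonempty vertex set; the order of $G$ is $|V(G)|$; $\overline G$ is the complement of $G$. Power domination: for $B\subseteq V(G)$ put $B^{[0]}=B$ and $B^{[1]}=N[B]$ (the vertices of $B$ and all their neighbors); for $i\ge1$, $B^{[i+1]}$ is $B^{[i]}$ together with every vertex $w\notin B^{[i]}$ that is the unique neighbor outside $B^{[i]}$ of some vertex $v\in B^{[i]}$. $\operatorname{pt}_{\gamma_P}(G;B)$ is the least $t$ with $B^{[t]}=V(G)$ ($\infty$ if none exists), and $\operatorname{pt}_{\gamma_P}(G,k)=\min_{|B|=k}\operatorname{pt}_{\gamma_P}(G;B)$. For $G$ of order $n$ the initial cost product throttling number is $\operatorname{th}_{\gamma_P}^{\times}(G)=\min_{1\le k\le n}k(1+\operatorname{pt}_{\gamma_P}(G,k))$. $f=\Theta(g)$ means there are positive constants $c,C,k$ with $c\,g(n)\le f(n)\le C\,g(n)$ for all $n\ge k$. *)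

theory Defs
  imports
    "Graph_Theory.Pair_Digraph"
    "HOL-Library.Extended_Nat"
    "HOL-Library.Landau_Symbols"
begin

text \<open>
  A finite simple undirected graph is a \<open>pair_graph\<close>: the edge \<open>{u, v}\<close> is represented by the two
  arcs \<open>(u, v)\<close> and \<open>(v, u)\<close>. The locale admits the graph without vertices, which is excluded here.
\<close>

definition simple_graph :: "'a pair_pre_digraph \<Rightarrow> bool" where
  "simple_graph G \<longleftrightarrow> pair_graph G \<and> pverts G \<noteq> {}"

definition order :: "'a pair_pre_digraph \<Rightarrow> nat" where
  "order G = card (pverts G)"

definition complement :: "'a pair_pre_digraph \<Rightarrow> 'a pair_pre_digraph" where
  "complement G = \<lparr> pverts = pverts G,
     parcs = {(u, v). u \<in> pverts G \<and> v \<in> pverts G \<and> u \<noteq> v \<and> (u, v) \<notin> parcs G} \<rparr>"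

definition neighborhood :: "'a pair_pre_digraph \<Rightarrow> 'a \<Rightarrow> 'a set" where
  "neighborhood G v = {w. (v, w) \<in> parcs G}"

definition closed_neighborhood :: "'a pair_pre_digraph \<Rightarrow> 'a set \<Rightarrow> 'a set" where
  "closed_neighborhood G B = B \<union> (\<Union>v\<in>B. neighborhood G v)"

definition forcing_step :: "'a pair_pre_digraph \<Rightarrow> 'a set \<Rightarrow> 'a set" where
  "forcing_step G S = S \<union> {w. w \<notin> S \<and> (\<exists>v\<in>S. neighborhood G v - S = {w})}"

fun pd_set :: "'a pair_pre_digraph \<Rightarrow> 'a set \<Rightarrow> nat \<Rightarrow> 'a set" where
  "pd_set G B 0 = B"
| "pd_set G B (Suc 0) = closed_neighborhood G B"
| "pd_set G B (Suc (Suc i)) = forcing_step G (pd_set G B (Suc i))"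

text \<open>
  Infima in \<^typ>\<open>enat\<close> are attained, unless the index set is empty, in which case they are \<open>\<infinity>\<close>.
\<close>

definition pd_prop_time_of :: "'a pair_pre_digraph \<Rightarrow> 'a set \<Rightarrow> enat" where
  "pd_prop_time_of G B = (INF t\<in>{t. pd_set G B t = pverts G}. enat t)"

definition pd_prop_time :: "'a pair_pre_digraph \<Rightarrow> nat \<Rightarrow> enat" where
  "pd_prop_time G k = (INF B\<in>{B. B \<subseteq> pverts G \<and> card B = k}. pd_prop_time_of G B)"

definition pd_throttling_enat :: "'a pair_pre_digraph \<Rightarrow> enat" where
  "pd_throttling_enat G = (MIN k\<in>{1..order G}. enat k * (1 + pd_prop_time G k))"

text \<open>
  The minimum is always finite (lemma \<open>enat_pd_throttling\<close> below), so nothing is lost by regarding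
  the throttling number as a natural number.
\<close>

definition pd_throttling :: "'a pair_pre_digraph \<Rightarrow> nat" where
  "pd_throttling G = the_enat (pd_throttling_enat G)"

text \<open>
  Every finite graph is isomorphic to one whose vertices are natural numbers.
\<close>

definition throttling_products :: "nat \<Rightarrow> nat set" where
  "throttling_products n = {pd_throttling G * pd_throttling (complement G) |
     G :: nat pair_pre_digraph. simple_graph G \<and> order G = n}"

definition max_throttling_product :: "nat \<Rightarrow> nat" where
  "max_throttling_product n = Max (throttling_products n)"

lemma simple_graph_complement:
  assumes "simple_graph G"
  shows "simple_graph (complement G)"
proof -
  interpret pair_graph G using assms by (simp add: simple_graph_def)
  have "finite (parcs (complement G))"
    by (rule finite_subset[of _ "pverts G \<times> pverts G"])
       (auto simp: complement_def pair_finite_verts)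
  moreover have "symmetric (with_proj (complement G))"
    using pair_sym_arcs
    by (auto simp: complement_def symmetric_def arcs_ends_conv with_proj_def intro!: symI
             dest: symD)
  ultimately have "pair_graph (complement G)"
    by unfold_locales (auto simp: complement_def pair_finite_verts)
  thus ?thesis using assms by (simp add: simple_graph_def complement_def)
qed

lemma pd_throttling_enat_le_order:
  assumes "simple_graph G"
  shows "pd_throttling_enat G \<le> enat (order G)"
proof -
  interpret pair_graph G using assms by (simp add: simple_graph_def)
  have pos: "order G \<ge> 1"
    using assms pair_finite_verts
    by (simp add: simple_graph_def order_def Suc_le_eq card_gt_0_iff)
  have "pd_prop_time_of G (pverts G) \<le> enat 0"
    unfolding pd_prop_time_of_def by (rule INF_lower) simp
  moreover have "pd_prop_time G (order G) \<le> pd_prop_time_of G (pverts G)"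
    unfolding pd_prop_time_def by (rule INF_lower) (simp add: order_def)
  ultimately have "pd_prop_time G (order G) = 0"
    by (simp add: zero_enat_def[symmetric])
  moreover have "pd_throttling_enat G \<le> enat (order G) * (1 + pd_prop_time G (order G))"
    unfolding pd_throttling_enat_def using pos by (intro Min_le) auto
  ultimately show ?thesis by simp
qed

lemma enat_pd_throttling:
  assumes "simple_graph G"
  shows "enat (pd_throttling G) = pd_throttling_enat G"
  using pd_throttling_enat_le_order[OF assms] unfolding pd_throttling_def
  by (cases "pd_throttling_enat G") auto

lemma pd_throttling_le_order:
  assumes "simple_graph G"
  shows "pd_throttling G \<le> order G"
  using pd_throttling_enat_le_order[OF assms] enat_pd_throttling[OF assms]
  by (metis enat_ord_simps(1))

lemma finite_throttling_products: "finite (throttling_products n)"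
proof (rule finite_subset)
  show "throttling_products n \<subseteq> {..n * n}"
  proof
    fix x assume "x \<in> throttling_products n"
    then obtain G :: "nat pair_pre_digraph" where G: "simple_graph G" "order G = n"
      and x: "x = pd_throttling G * pd_throttling (complement G)"
      by (auto simp: throttling_products_def)
    have "order (complement G) = n"
      using G(2) by (simp add: order_def complement_def)
    thus "x \<in> {..n * n}"
      using x G pd_throttling_le_order[OF G(1)]
        pd_throttling_le_order[OF simple_graph_complement[OF G(1)]]
      by (simp add: mult_mono)
  qed
qed simp

lemma throttling_products_nonempty:
  assumes "n \<ge> 1"
  shows "throttling_products n \<noteq> {}"
proof -
  define G :: "nat pair_pre_digraph" where "G = \<lparr> pverts = {..<n}, parcs = {} \<rparr>"
  have "symmetric (with_proj G)"
    by (auto simp: G_def symmetric_def arcs_ends_conv with_proj_def intro!: symI)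
  hence "pair_graph G"
    by unfold_locales (auto simp: G_def)
  hence "simple_graph G" "order G = n"
    using assms by (auto simp: simple_graph_def order_def G_def lessThan_empty_iff)
  thus ?thesis by (auto simp: throttling_products_def)
qed

end

theory Submission
  imports Defs
begin

text \<open>
  The graph is the disjoint union of \<open>r\<close> copies of \<open>K\<^sub>3 \<union> C\<^sub>4\<close>. An initial set meets all \<open>2r\<close>
  components, and each \<open>C\<^sub>4\<close> twice if it dominates, so \<open>k(1 + t)\<close> is at least \<open>7r\<close>, \<open>2 \<cdot> 3r\<close> and
  \<open>3 \<cdot> 2r\<close> for \<open>t = 0\<close>, \<open>t = 1\<close> and \<open>t \<ge> 2\<close>. The complement has domination number 2, whence
  throttling number at most 4; a smaller value would need a single vertex with propagation time at
  most 2, but every vertex misses a pair of twins of the complement, and twins block each other.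

  For the order of growth, an edgeless graph has throttling number \<open>n\<close>. Conversely, the throttling
  number is at most twice the domination number, and \<open>\<gamma>(G) \<gamma>(G') \<le> n\<close> for the complement \<open>G'\<close>
  by a theorem of Jaeger and Payan.
\<close>

section \<open>Bounds for the throttling number\<close>

text \<open>An empty index set would give the infimum \<infinity>, so a finite value forces a
  nonempty one, and a well-order attains its infimum there.\<close>

lemma INF_enat_attained:
  fixes f :: "'b \<Rightarrow> enat"
  assumes "(INF x\<in>A. f x) = enat t"
  obtains x where "x \<in> A" "f x = enat t"
proof -
  have "A \<noteq> {}" using assms by (auto simp: top_enat_def)
  then have "(INF x\<in>A. f x) \<in> f ` A" by (auto intro: wellorder_InfI)
  with assms that show ?thesis by auto
qed

lemma simple_graph_finite:
  assumes "simple_graph G"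
  shows "finite (pverts G)"
proof -
  interpret pair_graph G using assms by (simp add: simple_graph_def)
  show ?thesis by (rule pair_finite_verts)
qed

text \<open>A single successful pair of \<open>B\<close> and \<open>t\<close> is a certificate for
  an upper bound; \<open>t\<close> may exceed the propagation time.\<close>

lemma pd_throttling_le:
  assumes G: "simple_graph G" and B: "B \<subseteq> pverts G" "pd_set G B t = pverts G"
    and ne: "B \<noteq> {}"
  shows "pd_throttling G \<le> card B * (1 + t)"
proof -
  have fin: "finite B" using B simple_graph_finite[OF G] finite_subset by auto
  have k: "card B \<in> {1..order G}"
    using fin ne B simple_graph_finite[OF G]
    by (auto simp: order_def Suc_le_eq card_gt_0_iff card_mono)
  have "pd_prop_time G (card B) \<le> pd_prop_time_of G B"
    unfolding pd_prop_time_def using B by (intro INF_lower) auto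
  also have "\<dots> \<le> enat t"
    unfolding pd_prop_time_of_def using B by (intro INF_lower) auto
  finally have "enat (card B) * (1 + pd_prop_time G (card B)) \<le> enat (card B) * (1 + enat t)"
    by (intro mult_left_mono add_left_mono) auto
  moreover have "pd_throttling_enat G \<le> enat (card B) * (1 + pd_prop_time G (card B))"
    unfolding pd_throttling_enat_def using k by (intro Min_le) auto
  ultimately have "enat (pd_throttling G) \<le> enat (card B) * (1 + enat t)"
    unfolding enat_pd_throttling[OF G] by (rule order_trans[rotated])
  then show ?thesis by (simp add: one_enat_def)
qed

text \<open>Finite minima are attained, so a lower bound only has to be checked on actual successful
  pairs of \<open>B\<close> and \<open>t\<close>.\<close>

lemma pd_throttling_ge:
  assumes G: "simple_graph G"
    and ge: "\<And>B t. B \<subseteq> pverts G \<Longrightarrow> B \<noteq> {} \<Longrightarrow> pd_set G B t = pverts G \<Longrightarrow> m \<le> card B * (1 + t)"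
  shows "m \<le> pd_throttling G"
proof -
  have V: "finite (pverts G)" "pverts G \<noteq> {}"
    using G simple_graph_finite by (auto simp: simple_graph_def)
  then have "order G \<ge> 1" by (simp add: order_def Suc_le_eq card_gt_0_iff)
  moreover have "enat m \<le> enat k * (1 + pd_prop_time G k)" if k: "k \<in> {1..order G}" for k
  proof (cases "pd_prop_time G k")
    case (enat t)
    then obtain B where B: "B \<subseteq> pverts G" "card B = k" "pd_prop_time_of G B = enat t"
      unfolding pd_prop_time_def by (rule INF_enat_attained) auto
    from B(3) have "pd_set G B t = pverts G"
      unfolding pd_prop_time_of_def by (rule INF_enat_attained) auto
    moreover have "B \<noteq> {}" using B k by auto
    ultimately have "m \<le> k * (1 + t)" using B ge[of B t] by auto
    then show ?thesis using enat by (simp add: one_enat_def)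
  next
    \<comment> \<open>Here \<open>k \<ge> 1\<close> matters: the product is then \<infinity>,
      whereas \<open>0 * \<infinity>\<close> is \<open>0\<close>.\<close>
    case infinity
    then show ?thesis using k by (simp add: zero_enat_def)
  qed
  ultimately have "enat m \<le> pd_throttling_enat G"
    unfolding pd_throttling_enat_def by (intro Min.boundedI) auto
  then show ?thesis by (simp flip: enat_pd_throttling[OF G])
qed

section \<open>The theorem of Jaeger and Payan\<close>

text \<open>A non-neighbour \<open>w\<close> of \<open>x\<close> in \<open>S\<close> differs from
  \<open>x\<close>, as \<open>x\<close> lies outside \<open>S\<close>, and so is a neighbour in the
  complement.\<close>

lemma closed_neighborhood_complement_eq:
  assumes "S \<subseteq> pverts G" "\<And>x. x \<in> pverts G - S \<Longrightarrow> \<exists>w\<in>S. (w, x) \<notin> parcs G"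
  shows "closed_neighborhood (complement G) S = pverts G"
  using assms by (fastforce simp: closed_neighborhood_def neighborhood_def complement_def)

text \<open>
  A smallest dominating set \<open>D\<close> gives a partition of the vertices, here the fibres of \<open>f\<close>, each with
  a vertex that dominates its own fibre. Take one with as many such vertices as possible. If \<open>x\<close> were
  adjacent to a whole fibre other than its own, then moving \<open>x\<close> there would increase their number,
  unless \<open>x\<close> dominates both fibres, against the minimality of \<open>D\<close>. So each fibre dominates the
  complement.
\<close>

lemma Jaeger_Payan:
  assumes G: "simple_graph G"
  obtains D D' where "D \<subseteq> pverts G" "D \<noteq> {}" "closed_neighborhood G D = pverts G"
    "D' \<subseteq> pverts G" "D' \<noteq> {}" "closed_neighborhood (complement G) D' = pverts G"
    "card D * card D' \<le> order G"
proof -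
  interpret pair_graph G using G by (simp add: simple_graph_def)
  let ?V = "pverts G"
  have finV: "finite ?V" and neV: "?V \<noteq> {}"
    using G simple_graph_finite by (auto simp: simple_graph_def)
  have sym: "(u, v) \<in> parcs G" if "(v, u) \<in> parcs G" for u v
    using that pair_sym_arcs
    by (auto simp: symmetric_def arcs_ends_conv with_proj_def dest: symD)
  define dom where "dom D \<longleftrightarrow> D \<subseteq> ?V \<and> closed_neighborhood G D = ?V" for D
  have domI: "dom D" if "D \<subseteq> ?V" "\<And>x. x \<in> ?V \<Longrightarrow> \<exists>d\<in>D. x = d \<or> (d, x) \<in> parcs G" for D
    using that in_arcsD2
    by (fastforce simp: dom_def closed_neighborhood_def neighborhood_def)
  have "dom ?V" by (rule domI) auto
  then obtain D where D: "dom D" and Dmin: "\<And>E. dom E \<Longrightarrow> card D \<le> card E"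
    using ex_has_least_nat[of dom ?V card] by blast
  have finD: "finite D" using D finite_subset[OF _ finV] by (auto simp: dom_def)
  \<comment> \<open>\<open>full f\<close> collects the vertices that dominate their own fibre;
    \<open>ok f\<close> asks that every label in \<open>D\<close> has such a vertex.\<close>
  define full where
    "full f = {u \<in> ?V. \<forall>w\<in>?V. f w = f u \<longrightarrow> w = u \<or> (u, w) \<in> parcs G}" for f :: "'a \<Rightarrow> 'a"
  define ok where "ok f \<longleftrightarrow> f ` ?V \<subseteq> D \<and> D \<subseteq> f ` full f" for f
  \<comment> \<open>Assign each vertex to a dominator, and the vertices of \<open>D\<close> to
    themselves, so that each \<open>d\<close> lies in the fibre it dominates.\<close>
  have "\<forall>x\<in>?V. \<exists>d. d \<in> D \<and> (x \<in> D \<longrightarrow> x = d) \<and> (x = d \<or> (d, x) \<in> parcs G)"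
  proof
    fix x assume "x \<in> ?V"
    then have "x \<in> closed_neighborhood G D" using D by (simp add: dom_def)
    then show "\<exists>d. d \<in> D \<and> (x \<in> D \<longrightarrow> x = d) \<and> (x = d \<or> (d, x) \<in> parcs G)"
      by (cases "x \<in> D") (auto simp: closed_neighborhood_def neighborhood_def)
  qed
  from bchoice[OF this] obtain f0
    where f0: "\<forall>x\<in>?V. f0 x \<in> D \<and> (x \<in> D \<longrightarrow> x = f0 x) \<and> (x = f0 x \<or> (f0 x, x) \<in> parcs G)"
    by blast
  have "d \<in> f0 ` full f0" if "d \<in> D" for d
  proof -
    have "d \<in> ?V" using that D by (auto simp: dom_def)
    then have "f0 d = d" "d \<in> full f0" using f0 that by (force simp: full_def)+
    then show ?thesis by force
  qed
  with f0 have "ok f0" by (auto simp: ok_def)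
  \<comment> \<open>A uniform bound on the number of full vertices guarantees that a maximal
    \<open>f\<close> exists.\<close>
  moreover have "\<forall>g. ok g \<longrightarrow> card (full g) < Suc (card ?V)"
    using finV by (auto simp: full_def less_Suc_eq_le intro: card_mono)
  ultimately obtain f
    where f: "ok f" and fmax: "\<And>g. ok g \<Longrightarrow> card (full g) \<le> card (full f)"
    using Lattices_Big.ex_has_greatest_nat[of ok f0 "\<lambda>g. card (full g)"] by blast
  define P where "P d = {v \<in> ?V. f v = d}" for d
  have fin_full: "finite (full g)" for g using finV by (simp add: full_def)
  have Pdom: "closed_neighborhood (complement G) (P d) = ?V" if d: "d \<in> D" for d
  proof (rule closed_neighborhood_complement_eq, goal_cases)
    case 1
    show ?case by (auto simp: P_def)
  next
    case (2 x)
    then have x: "x \<in> ?V" "f x \<noteq> d" by (auto simp: P_def)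
    show ?case
    proof (rule ccontr)
      assume "\<not> (\<exists>w\<in>P d. (w, x) \<notin> parcs G)"
      then have adj: "(x, w) \<in> parcs G" if "w \<in> ?V" "f w = d" for w
        using that sym by (auto simp: P_def)
      \<comment> \<open>\<open>h\<close> chooses one full vertex from each fibre; the image of
        \<open>D\<close> is again a dominating set.\<close>
      have "\<forall>e\<in>D. \<exists>u. u \<in> full f \<and> f u = e" using f unfolding ok_def by blast
      from bchoice[OF this] obtain h where h: "\<And>e. e \<in> D \<Longrightarrow> h e \<in> full f \<and> f (h e) = e"
        by blast
      show False
      proof (cases "x \<in> full f")
        case True
        \<comment> \<open>\<open>x\<close> dominates the fibre of \<open>d\<close> by
          \<open>adj\<close> and its own fibre because it is full; the representatives of the
          remaining fibres do the rest, and one vertex is saved.\<close>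
        let ?E = "insert x (h ` (D - {d, f x}))"
        have "dom ?E"
        proof (rule domI)
          show "?E \<subseteq> ?V" using x h by (auto simp: full_def)
          fix y assume y: "y \<in> ?V"
          then have "f y \<in> D" using f by (auto simp: ok_def)
          show "\<exists>e\<in>?E. y = e \<or> (e, y) \<in> parcs G"
          proof (cases "f y \<in> {d, f x}")
            case True
            then show ?thesis using adj y \<open>x \<in> full f\<close> by (auto simp: full_def)
          next
            case False
            then show ?thesis using h[OF \<open>f y \<in> D\<close>] y \<open>f y \<in> D\<close> by (auto simp: full_def)
          qed
        qed
        then have "card D \<le> card ?E" by (rule Dmin)
        also have "\<dots> \<le> Suc (card (h ` (D - {d, f x})))"
          using finD by (simp add: card_insert_if)
        also have "\<dots> \<le> Suc (card (D - {d, f x}))"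
          using finD by (simp add: card_image_le)
        also have "\<dots> < card D"
        proof -
          \<comment> \<open>Subtraction is on naturals: the distinct labels \<open>d\<close> and
            \<open>f x\<close> make \<open>card D\<close> at least 2.\<close>
          have fx: "f x \<in> D" using f x by (auto simp: ok_def)
          then have "card {d, f x} \<le> card D" using d finD by (intro card_mono) auto
          then show ?thesis using d fx x finD by (subst card_Diff_subset) auto
        qed
        finally show False by simp
      next
        case False
        \<comment> \<open>The move keeps full vertices full: those in the fibre of \<open>d\<close>
          are adjacent to \<open>x\<close>, and the others gain nothing to dominate. In addition,
          \<open>x\<close> becomes full.\<close>
        let ?g = "f(x := d)"
        have sub: "full f \<subseteq> full ?g"
        proof
          fix u assume u: "u \<in> full f"
          then have "u \<noteq> x" using False by auto
          then show "u \<in> full ?g" using u adj sym by (auto simp: full_def)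
        qed
        have "x \<in> full ?g" using x adj by (auto simp: full_def)
        then have "full f \<subset> full ?g" using sub False by auto
        then have "card (full f) < card (full ?g)" by (rule psubset_card_mono[OF fin_full])
        moreover have "ok ?g"
          unfolding ok_def
        proof
          show "?g ` ?V \<subseteq> D" using f d by (auto simp: ok_def)
          \<comment> \<open>\<open>h e\<close> is full, hence different from \<open>x\<close>, and
            keeps its label.\<close>
          show "D \<subseteq> ?g ` full ?g"
          proof
            fix e assume "e \<in> D"
            with h[OF this] False sub show "e \<in> ?g ` full ?g"
              by (metis fun_upd_other image_eqI subsetD)
          qed
        qed
        ultimately show False using fmax by fastforce
      qed
    qed
  qed
  have "D \<noteq> {}"
    using D neV by (auto simp: dom_def closed_neighborhood_def)
  then obtain d where d: "d \<in> D" "\<And>e. e \<in> D \<Longrightarrow> card (P d) \<le> card (P e)"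
    using ex_has_least_nat[of "\<lambda>e. e \<in> D" _ "\<lambda>e. card (P e)"] by blast
  \<comment> \<open>The fibres are disjoint, so a smallest one has at most the average size.\<close>
  have "card D * card (P d) \<le> (\<Sum>e\<in>D. card (P e))"
    using sum_bounded_below[of D "card (P d)" "\<lambda>e. card (P e)"] d by simp
  also have "\<dots> = card (\<Union>e\<in>D. P e)"
    using finD finV by (subst card_UN_disjoint) (auto simp: P_def)
  also have "\<dots> \<le> card ?V" using finV by (intro card_mono) (auto simp: P_def)
  finally have "card D * card (P d) \<le> order G" by (simp add: order_def)
  moreover have "P d \<noteq> {}" using f d by (auto simp: ok_def P_def full_def)
  moreover have "P d \<subseteq> ?V" by (auto simp: P_def)
  ultimately show ?thesis
    using that[of D "P d"] D \<open>D \<noteq> {}\<close> Pdom[OF d(1)] by (auto simp: dom_def)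
qed

lemma pd_throttling_le_dominating:
  assumes "simple_graph G" "B \<subseteq> pverts G" "B \<noteq> {}" "closed_neighborhood G B = pverts G"
  shows "pd_throttling G \<le> 2 * card B"
  using pd_throttling_le[of G B 1] assms by simp

lemma pd_throttling_mult_complement_le:
  assumes G: "simple_graph G"
  shows "pd_throttling G * pd_throttling (complement G) \<le> 4 * order G"
proof -
  obtain D D' where D: "D \<subseteq> pverts G" "D \<noteq> {}" "closed_neighborhood G D = pverts G"
    and D': "D' \<subseteq> pverts G" "D' \<noteq> {}" "closed_neighborhood (complement G) D' = pverts G"
    and le: "card D * card D' \<le> order G"
    by (rule Jaeger_Payan[OF G])
  have "pd_throttling G \<le> 2 * card D"
    using G D by (rule pd_throttling_le_dominating)
  moreover have "pd_throttling (complement G) \<le> 2 * card D'"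
    using D' by (intro pd_throttling_le_dominating simple_graph_complement[OF G])
      (auto simp: complement_def)
  ultimately have "pd_throttling G * pd_throttling (complement G) \<le> (2 * card D) * (2 * card D')"
    by (rule mult_le_mono)
  with le show ?thesis by simp
qed

section \<open>Propagation\<close>

text \<open>No arc enters \<open>C\<close> from outside, and both domination and forcing proceed
  along arcs. In an undirected graph such a \<open>C\<close> is a union of components.\<close>

lemma pd_set_disjoint:
  assumes "B \<inter> C = {}" and closed: "\<And>u w. (u, w) \<in> parcs G \<Longrightarrow> w \<in> C \<Longrightarrow> u \<in> C"
  shows "pd_set G B t \<inter> C = {}"
proof (induction t)
  case 0
  show ?case using assms(1) by simp
next
  case (Suc t)
  show ?case
  proof (cases t)
    case 0
    have "neighborhood G v \<inter> C = {}" if "v \<in> B" for v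
      using closed assms(1) that by (auto simp: neighborhood_def)
    then show ?thesis using 0 assms(1) by (auto simp: closed_neighborhood_def)
  next
    case (Suc i)
    have "neighborhood G v \<inter> C = {}" if "v \<in> pd_set G B t" for v
      using closed Suc.IH that by (auto simp: neighborhood_def)
    then show ?thesis using Suc Suc.IH by (auto simp: forcing_step_def)
  qed
qed

text \<open>A vertex of \<open>S\<close> adjacent to \<open>a\<close> is also adjacent to
  \<open>b\<close>, so \<open>a\<close> is never its only neighbour outside
  \<open>S\<close>.\<close>

lemma twin_notin_forcing_step:
  assumes "a \<notin> S" "b \<notin> S" "a \<noteq> b"
    and "\<And>u. u \<in> S \<Longrightarrow> (u, a) \<in> parcs G \<longleftrightarrow> (u, b) \<in> parcs G"
  shows "a \<notin> forcing_step G S"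
  using assms by (fastforce simp: forcing_step_def neighborhood_def)

lemma pd_throttling_edgeless:
  assumes G: "simple_graph G" and "parcs G = {}"
  shows "order G \<le> pd_throttling G"
proof (rule pd_throttling_ge[OF G])
  fix B t assume B: "B \<subseteq> pverts G" and "pd_set G B t = pverts G"
  moreover have "pd_set G B t \<inter> (- B) = {}"
    by (rule pd_set_disjoint) (use assms in auto)
  ultimately have "B = pverts G" by auto
  then show "order G \<le> card B * (1 + t)" by (simp add: order_def)
qed

section \<open>Disjoint copies of a triangle and a four-cycle\<close>

text \<open>
  In the block of numbers \<open>7j, \<dots>, 7j + 6\<close> the residues 0, 1, 2 form the triangle, and the residues
  3, 4, 5, 6 form the four-cycle, as the complete bipartite graph between \<open>{3, 5}\<close> and \<open>{4, 6}\<close>.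
\<close>

definition residue_adj :: "nat \<Rightarrow> nat \<Rightarrow> bool" where
  "residue_adj a b \<longleftrightarrow> a < 3 \<and> b < 3 \<and> a \<noteq> b \<or> 3 \<le> a \<and> 3 \<le> b \<and> even a \<noteq> even b"

definition triangle_square_adj :: "nat \<Rightarrow> nat \<Rightarrow> bool" where
  "triangle_square_adj u v \<longleftrightarrow> u div 7 = v div 7 \<and> residue_adj (u mod 7) (v mod 7)"

lemma residue_adj_irrefl: "\<not> residue_adj a a"
  by (simp add: residue_adj_def)

lemma residue_adj_sym: "residue_adj a b \<Longrightarrow> residue_adj b a"
  by (auto simp: residue_adj_def)

text \<open>The missed residue is the opposite corner, so one vertex cannot dominate the
  four-cycle.\<close>

lemma residue_adj_square_miss:
  assumes "a < 7" "3 \<le> a"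
  shows "\<exists>b<7. 3 \<le> b \<and> b \<noteq> a \<and> \<not> residue_adj a b"
proof -
  have "a = 3 \<or> a = 4 \<or> a = 5 \<or> a = 6" using assms by auto
  then show ?thesis
  proof (elim disjE)
    assume "a = 3" then show ?thesis by (intro exI[of _ 5]) (simp add: residue_adj_def)
  next
    assume "a = 4" then show ?thesis by (intro exI[of _ 6]) (simp add: residue_adj_def)
  next
    assume "a = 5" then show ?thesis by (intro exI[of _ 3]) (simp add: residue_adj_def)
  next
    assume "a = 6" then show ?thesis by (intro exI[of _ 4]) (simp add: residue_adj_def)
  qed
qed

text \<open>\<open>0\<close> covers the triangle; in the other part \<open>3\<close> is adjacent to
  the even residues and \<open>4\<close> to the odd ones.\<close>

lemma residue_adj_dominated: "\<exists>a\<in>{0, 3, 4}. b = a \<or> residue_adj a b"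
  by (cases "b < 3"; cases "even b") (auto simp: residue_adj_def)

text \<open>The twins are the other two triangle vertices, or the side of the bipartition opposite
  to \<open>i\<close>. In the complement \<open>i\<close> reaches neither of them. Triangle twins
  are adjacent to each other, hence the exclusion of \<open>a\<close> and \<open>b\<close> from the
  twin condition.\<close>

lemma residue_adj_twins:
  assumes "i < 7"
  obtains a b where "a < 7" "b < 7" "a \<noteq> b" "residue_adj i a" "residue_adj i b"
    "\<And>c. c \<noteq> a \<Longrightarrow> c \<noteq> b \<Longrightarrow> residue_adj c a \<longleftrightarrow> residue_adj c b"
proof -
  have "i \<in> {0, 1, 2, 3, 4, 5, 6}" using assms by auto
  then consider "i = 0" | "i = 1" | "i = 2" | "i = 3 \<or> i = 5" | "i = 4 \<or> i = 6" by blast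
  then show ?thesis
  proof cases
    case 1
    show ?thesis by (rule that[of 1 2]) (use 1 in \<open>auto simp: residue_adj_def\<close>)
  next
    case 2
    show ?thesis by (rule that[of 0 2]) (use 2 in \<open>auto simp: residue_adj_def\<close>)
  next
    case 3
    show ?thesis by (rule that[of 0 1]) (use 3 in \<open>auto simp: residue_adj_def\<close>)
  next
    case 4
    show ?thesis by (rule that[of 4 6]) (use 4 in \<open>auto simp: residue_adj_def\<close>)
  next
    case 5
    show ?thesis by (rule that[of 3 5]) (use 5 in \<open>auto simp: residue_adj_def\<close>)
  qed
qed

definition triangle_squares :: "nat \<Rightarrow> nat pair_pre_digraph" where
  "triangle_squares r = \<lparr> pverts = {..<7 * r},
     parcs = {(u, v). u < 7 * r \<and> v < 7 * r \<and> triangle_square_adj u v} \<rparr>"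

lemma pverts_triangle_squares [simp]: "pverts (triangle_squares r) = {..<7 * r}"
  by (simp add: triangle_squares_def)

lemma order_triangle_squares [simp]: "order (triangle_squares r) = 7 * r"
  by (simp add: order_def)

lemma parcs_triangle_squares:
  "(u, v) \<in> parcs (triangle_squares r) \<longleftrightarrow> u < 7 * r \<and> v < 7 * r \<and> triangle_square_adj u v"
  by (simp add: triangle_squares_def)

lemma block_less: "7 * j + a < 7 * r" if "j < r" "a < 7" for a j r :: nat
  using that by linarith

lemma simple_graph_triangle_squares:
  assumes "r \<ge> 1"
  shows "simple_graph (triangle_squares r)"
proof -
  let ?G = "triangle_squares r"
  have "finite (parcs ?G)"
    by (rule finite_subset[of _ "{..<7 * r} \<times> {..<7 * r}"]) (auto simp: triangle_squares_def)
  moreover have "symmetric (with_proj ?G)"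
    by (auto simp: triangle_squares_def triangle_square_adj_def symmetric_def arcs_ends_conv
        with_proj_def residue_adj_sym intro!: symI)
  ultimately have "pair_graph ?G"
    by unfold_locales
      (auto simp: triangle_squares_def triangle_square_adj_def residue_adj_irrefl)
  then show ?thesis using assms by (auto simp: simple_graph_def lessThan_empty_iff)
qed

section \<open>Counting initial sets block by block\<close>

lemma card_eq_sum_blocks:
  assumes "B \<subseteq> {..<7 * r :: nat}"
  shows "card B = (\<Sum>j<r. card {v \<in> B. v div 7 = j})"
proof -
  have "v div 7 < r" if "v \<in> B" for v
    using assms that by (auto simp: less_mult_imp_div_less mult.commute)
  then have "B = (\<Union>j<r. {v \<in> B. v div 7 = j})" by auto
  moreover have "finite B" using assms finite_subset by blast
  then have "card (\<Union>j<r. {v \<in> B. v div 7 = j}) = (\<Sum>j<r. card {v \<in> B. v div 7 = j})"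
    by (intro card_UN_disjoint) auto
  ultimately show ?thesis by simp
qed

lemma card_ge_blocks:
  assumes "B \<subseteq> {..<7 * r :: nat}" and "\<And>j. j < r \<Longrightarrow> \<exists>X. X \<subseteq> B \<and> (\<forall>v\<in>X. v div 7 = j) \<and> card X = m"
  shows "m * r \<le> card B"
proof -
  have "m \<le> card {v \<in> B. v div 7 = j}" if j: "j < r" for j
  proof -
    obtain X where X: "X \<subseteq> B" "\<forall>v\<in>X. v div 7 = j" "card X = m"
      using assms(2)[OF j] by auto
    have "finite B" using assms(1) finite_subset by blast
    then have "card X \<le> card {v \<in> B. v div 7 = j}" using X by (intro card_mono) auto
    then show ?thesis using X by simp
  qed
  then have "(\<Sum>j<r. m) \<le> card B"
    unfolding card_eq_sum_blocks[OF assms(1)] by (intro sum_mono) auto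
  then show ?thesis by (simp add: mult.commute)
qed

text \<open>No arc enters \<open>?T\<close> or \<open>?S\<close> from outside, so propagation
  reaches each of them only from an initial vertex inside it.\<close>

lemma triangle_squares_meets_components:
  assumes "pd_set (triangle_squares r) B t = {..<7 * r}" "j < r"
  shows "\<exists>v\<in>B. v div 7 = j \<and> v mod 7 < 3" and "\<exists>v\<in>B. v div 7 = j \<and> 3 \<le> v mod 7"
proof -
  let ?T = "{v. v div 7 = j \<and> v mod 7 < 3}" and ?S = "{v. v div 7 = j \<and> 3 \<le> v mod 7}"
  have "B \<inter> ?T \<noteq> {}"
  proof
    assume "B \<inter> ?T = {}"
    then have "pd_set (triangle_squares r) B t \<inter> ?T = {}"
      by (rule pd_set_disjoint) (auto simp: parcs_triangle_squares triangle_square_adj_def residue_adj_def)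
    moreover have "7 * j \<in> {..<7 * r} \<inter> ?T" using assms(2) by auto
    ultimately show False using assms(1) by blast
  qed
  then show "\<exists>v\<in>B. v div 7 = j \<and> v mod 7 < 3" by blast
  have "B \<inter> ?S \<noteq> {}"
  proof
    assume "B \<inter> ?S = {}"
    then have "pd_set (triangle_squares r) B t \<inter> ?S = {}"
      by (rule pd_set_disjoint) (auto simp: parcs_triangle_squares triangle_square_adj_def residue_adj_def)
    moreover have "7 * j + 3 \<in> {..<7 * r} \<inter> ?S" using assms(2) by auto
    ultimately show False using assms(1) by blast
  qed
  then show "\<exists>v\<in>B. v div 7 = j \<and> 3 \<le> v mod 7" by blast
qed

lemma dominating_triangle_squares_square:
  assumes "closed_neighborhood (triangle_squares r) B = {..<7 * r}" "j < r"
  shows "\<exists>x\<in>B. \<exists>y\<in>B. x \<noteq> y \<and> x div 7 = j \<and> 3 \<le> x mod 7 \<and> y div 7 = j \<and> 3 \<le> y mod 7"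
proof (rule ccontr)
  assume neg: "\<not> ?thesis"
  have dom: "v \<in> B \<or> (\<exists>u\<in>B. triangle_square_adj u v)" if "v < 7 * r" for v
  proof -
    have "v \<in> closed_neighborhood (triangle_squares r) B" using assms(1) that by simp
    then show ?thesis
      by (auto simp: closed_neighborhood_def neighborhood_def parcs_triangle_squares)
  qed
  have near: "\<exists>u\<in>B. u div 7 = j \<and> (u mod 7 = i \<or> residue_adj (u mod 7) i)" if i: "i < 7" for i
    using dom[OF block_less[OF assms(2) i]]
  proof
    assume "7 * j + i \<in> B"
    then show ?thesis using i by (intro bexI[of _ "7 * j + i"]) auto
  next
    assume "\<exists>u\<in>B. triangle_square_adj u (7 * j + i)"
    then show ?thesis using i by (auto simp: triangle_square_adj_def)
  qed
  \<comment> \<open>Dominating residue 3 requires some vertex \<open>x\<close> of the four-cycle;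
    its opposite corner \<open>b\<close> then requires a second one.\<close>
  obtain x where x: "x \<in> B" "x div 7 = j" "3 \<le> x mod 7"
    using near[of 3] by (auto simp: residue_adj_def)
  obtain b where b: "b < 7" "3 \<le> b" "b \<noteq> x mod 7" "\<not> residue_adj (x mod 7) b"
    using residue_adj_square_miss[OF _ x(3)] by auto
  obtain y where y: "y \<in> B" "y div 7 = j" "y mod 7 = b \<or> residue_adj (y mod 7) b"
    using near[OF b(1)] by blast
  then have "3 \<le> y mod 7" "y \<noteq> x" using b by (auto simp: residue_adj_def)
  then show False using neg x y by blast
qed

lemma pd_throttling_triangle_squares:
  assumes "r \<ge> 1"
  shows "pd_throttling (triangle_squares r) = 6 * r"
proof (rule antisym)
  let ?G = "triangle_squares r"
  note G = simple_graph_triangle_squares[OF assms]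
  \<comment> \<open>One triangle vertex and two adjacent corners of the four-cycle in each block:
    \<open>3 * r\<close> vertices that dominate, at cost \<open>2 * (3 * r)\<close>.\<close>
  let ?B = "{v. v < 7 * r \<and> v mod 7 \<in> {0, 3, 4}}"
  have dom: "v \<in> closed_neighborhood ?G ?B" if v: "v < 7 * r" for v
  proof -
    obtain a where a: "a \<in> {0, 3, 4}" "v mod 7 = a \<or> residue_adj a (v mod 7)"
      using residue_adj_dominated by blast
    let ?u = "7 * (v div 7) + a"
    have "v div 7 < r" using v by (simp add: less_mult_imp_div_less mult.commute)
    moreover have a7: "a < 7" using a by auto
    ultimately have "?u < 7 * r" by (rule block_less)
    moreover have "?u mod 7 = a" using a7 by simp
    ultimately have u: "?u \<in> ?B" using a by simp
    have "v = ?u \<or> triangle_square_adj ?u v"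
      using a(2)
    proof
      assume "v mod 7 = a"
      then show ?thesis using mult_div_mod_eq[of 7 v] by simp
    qed (use a7 in \<open>simp add: triangle_square_adj_def\<close>)
    then show ?thesis
    proof
      assume eq: "v = ?u"
      have "v \<in> ?B" by (subst eq) (rule u)
      then show ?thesis by (simp add: closed_neighborhood_def)
    next
      assume "triangle_square_adj ?u v"
      then have "v \<in> neighborhood ?G ?u"
        using u v by (simp add: neighborhood_def parcs_triangle_squares)
      then show ?thesis unfolding closed_neighborhood_def by (intro UnI2 UN_I[OF u])
    qed
  qed
  have "closed_neighborhood ?G ?B = {..<7 * r}"
  proof
    show "closed_neighborhood ?G ?B \<subseteq> {..<7 * r}"
      by (auto simp: closed_neighborhood_def neighborhood_def parcs_triangle_squares)
  qed (rule subsetI, rule dom, simp)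
  moreover have "?B \<noteq> {}" using assms by (intro notI) (drule equals0D[of _ 0], simp)
  moreover have "?B \<subseteq> {..<7 * r}" by (rule subsetI) simp
  ultimately have "pd_throttling ?G \<le> 2 * card ?B"
    by (intro pd_throttling_le_dominating[OF G]) simp_all
  also have "card ?B = (\<Sum>j<r. card {v \<in> ?B. v div 7 = j})"
    by (rule card_eq_sum_blocks) auto
  also have "\<dots> = (\<Sum>j<r. 3)"
  proof (rule sum.cong)
    fix j assume "j \<in> {..<r}"
    then have j: "7 * j + 4 < 7 * r" by (intro block_less) auto
    have "{v \<in> ?B. v div 7 = j} = {7 * j, 7 * j + 3, 7 * j + 4}"
    proof (intro equalityI subsetI)
      fix v assume "v \<in> {v \<in> ?B. v div 7 = j}"
      then show "v \<in> {7 * j, 7 * j + 3, 7 * j + 4}"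
        using div_mult_mod_eq[of v 7] by auto
    next
      fix v assume "v \<in> {7 * j, 7 * j + 3, 7 * j + 4}"
      then show "v \<in> {v \<in> ?B. v div 7 = j}" using j by auto
    qed
    then show "card {v \<in> ?B. v div 7 = j} = 3" by simp
  qed simp
  finally show "pd_throttling ?G \<le> 6 * r" by simp
  show "6 * r \<le> pd_throttling ?G"
  proof (rule pd_throttling_ge[OF G])
    fix B t
    assume B: "B \<subseteq> pverts ?G" and "pd_set ?G B t = pverts ?G"
    then have t: "pd_set ?G B t = {..<7 * r}" and B': "B \<subseteq> {..<7 * r}" by auto
    consider "t = 0" | "t = 1" | "t \<ge> 2" by linarith
    then show "6 * r \<le> card B * (1 + t)"
    proof cases
      case 1
      then show ?thesis using t by simp
    next
      case 2
      have "3 * r \<le> card B"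
      proof (rule card_ge_blocks[OF B'])
        fix j assume j: "j < r"
        obtain v where v: "v \<in> B" "v div 7 = j" "v mod 7 < 3"
          using triangle_squares_meets_components(1)[OF t j] by blast
        obtain x y where xy: "x \<in> B" "y \<in> B" "x \<noteq> y"
            "x div 7 = j" "3 \<le> x mod 7" "y div 7 = j" "3 \<le> y mod 7"
          using dominating_triangle_squares_square[of r B j] t 2 j by auto
        have "v \<noteq> x" "v \<noteq> y" using v xy by auto
        then show "\<exists>X. X \<subseteq> B \<and> (\<forall>v\<in>X. v div 7 = j) \<and> card X = 3"
          using v xy by (intro exI[of _ "{v, x, y}"]) auto
      qed
      then show ?thesis using 2 by simp
    next
      case 3
      have "2 * r \<le> card B"
      proof (rule card_ge_blocks[OF B'])
        fix j assume j: "j < r"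
        obtain v x where v: "v \<in> B" "v div 7 = j" "v mod 7 < 3"
            and x: "x \<in> B" "x div 7 = j" "3 \<le> x mod 7"
          using triangle_squares_meets_components(1)[OF t j]
            triangle_squares_meets_components(2)[OF t j] by blast
        have "v \<noteq> x" using v x by auto
        then show "\<exists>X. X \<subseteq> B \<and> (\<forall>v\<in>X. v div 7 = j) \<and> card X = 2"
          using v x by (intro exI[of _ "{v, x}"]) auto
      qed
      then have "(2 * r) * 3 \<le> card B * (1 + t)" using 3 by (intro mult_le_mono) auto
      then show ?thesis by simp
    qed
  qed
qed

section \<open>Twins and the throttling number of the complement\<close>

lemma triangle_squares_twin_neighbors:
  assumes "v < 7 * r"
  obtains a b where "a < 7 * r" "b < 7 * r" "a \<noteq> b"
    "triangle_square_adj v a" "triangle_square_adj v b"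
    "\<And>u. u \<noteq> a \<Longrightarrow> u \<noteq> b \<Longrightarrow> triangle_square_adj u a \<longleftrightarrow> triangle_square_adj u b"
proof -
  define j where "j = v div 7"
  have j: "j < r" "v = 7 * j + v mod 7"
    using assms by (auto simp: j_def less_mult_imp_div_less mult.commute)
  have "v mod 7 < 7" by simp
  then obtain a b where ab: "a < 7" "b < 7" "a \<noteq> b"
      "residue_adj (v mod 7) a" "residue_adj (v mod 7) b"
      and twin: "\<And>c. c \<noteq> a \<Longrightarrow> c \<noteq> b \<Longrightarrow> residue_adj c a \<longleftrightarrow> residue_adj c b"
    by (rule residue_adj_twins) blast
  show ?thesis
  proof (rule that[of "7 * j + a" "7 * j + b"])
    show "triangle_square_adj v (7 * j + a)" "triangle_square_adj v (7 * j + b)"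
      using ab by (simp_all add: triangle_square_adj_def j_def)
    fix u assume u: "u \<noteq> 7 * j + a" "u \<noteq> 7 * j + b"
    show "triangle_square_adj u (7 * j + a) \<longleftrightarrow> triangle_square_adj u (7 * j + b)"
    proof (cases "u div 7 = j")
      case True
      \<comment> \<open>Within one block the residue determines the vertex; vertices of other blocks
        are adjacent to neither twin.\<close>
      have "u = 7 * (u div 7) + u mod 7" by simp
      then have "u mod 7 \<noteq> a" "u mod 7 \<noteq> b" using u True by metis+
      then show ?thesis using twin ab by (simp add: triangle_square_adj_def)
    qed (use ab in \<open>simp add: triangle_square_adj_def\<close>)
  qed (use ab j block_less in auto)
qed

lemma pd_throttling_complement_triangle_squares:
  assumes "r \<ge> 1"
  shows "pd_throttling (complement (triangle_squares r)) = 4"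
proof (rule antisym)
  let ?H = "complement (triangle_squares r)"
  have H: "simple_graph ?H"
    by (rule simple_graph_complement[OF simple_graph_triangle_squares[OF assms]])
  have V: "pverts ?H = {..<7 * r}" by (simp add: complement_def)
  have arcs: "(u, v) \<in> parcs ?H \<longleftrightarrow> u < 7 * r \<and> v < 7 * r \<and> u \<noteq> v \<and> \<not> triangle_square_adj u v"
    for u v by (auto simp: complement_def parcs_triangle_squares)
  \<comment> \<open>\<open>0\<close> and \<open>3\<close> lie in different components of the first
    block, so no vertex is adjacent to both in the original graph.\<close>
  have "closed_neighborhood ?H {0, 3} = pverts (triangle_squares r)"
    using assms
    by (intro closed_neighborhood_complement_eq)
       (auto simp: parcs_triangle_squares triangle_square_adj_def residue_adj_def)
  then have "pd_throttling ?H \<le> 2 * card {0, 3 :: nat}"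
    using assms by (intro pd_throttling_le_dominating[OF H]) (auto simp: V)
  then show "pd_throttling ?H \<le> 4" by simp
  show "4 \<le> pd_throttling ?H"
  proof (rule pd_throttling_ge[OF H])
    fix B t
    assume B: "B \<subseteq> pverts ?H" "B \<noteq> {}" and t: "pd_set ?H B t = pverts ?H"
    show "4 \<le> card B * (1 + t)"
    proof (rule ccontr)
      assume lt: "\<not> 4 \<le> card B * (1 + t)"
      have "finite B" using B V finite_subset by fastforce
      then have pos: "card B \<ge> 1" using B by (simp add: Suc_le_eq card_gt_0_iff)
      \<comment> \<open>At time 0 the set \<open>B\<close> would be all \<open>7 * r \<ge> 7\<close>
        vertices.\<close>
      have "t \<noteq> 0" using t lt assms by (intro notI) (simp add: V)
      have "card B = 1"
      proof (rule ccontr)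
        assume "card B \<noteq> 1"
        then have "2 * 2 \<le> card B * (1 + t)"
          using pos \<open>t \<noteq> 0\<close> by (intro mult_le_mono) auto
        with lt show False by simp
      qed
      then obtain v where v: "B = {v}" by (auto simp: card_1_singleton_iff)
      then have "v < 7 * r" using B V by auto
      then obtain a b where ab: "a < 7 * r" "b < 7 * r" "a \<noteq> b"
          "triangle_square_adj v a" "triangle_square_adj v b"
          and twin: "\<And>u. u \<noteq> a \<Longrightarrow> u \<noteq> b \<Longrightarrow> triangle_square_adj u a \<longleftrightarrow> triangle_square_adj u b"
        by (rule triangle_squares_twin_neighbors) blast
      let ?S = "closed_neighborhood ?H {v}"
      have "v \<noteq> a" "v \<noteq> b" using ab by (auto simp: triangle_square_adj_def residue_adj_irrefl)
      then have S: "a \<notin> ?S" "b \<notin> ?S"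
        using ab by (auto simp: closed_neighborhood_def neighborhood_def arcs)
      then have "a \<notin> forcing_step ?H ?S"
      proof (rule twin_notin_forcing_step)
        fix u assume "u \<in> ?S"
        then have "u \<noteq> a" "u \<noteq> b" using S by auto
        then show "(u, a) \<in> parcs ?H \<longleftrightarrow> (u, b) \<in> parcs ?H"
          using twin ab by (auto simp: arcs)
      qed (fact ab)
      \<comment> \<open>Time 2 is domination followed by one forcing step, and \<open>a\<close> is
        missed by both.\<close>
      moreover have "t = 1 \<or> t = 2" using lt \<open>card B = 1\<close> \<open>t \<noteq> 0\<close> by auto
      ultimately have "a \<notin> pd_set ?H B t" using S v by (auto simp: numeral_2_eq_2)
      then show False using t V ab by auto
    qed
  qed
qed

section \<open>The order of growth\<close>

lemma max_throttling_product_le: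
  assumes "n \<ge> 1"
  shows "max_throttling_product n \<le> 4 * n"
proof -
  have "max_throttling_product n \<in> throttling_products n"
    unfolding max_throttling_product_def
    by (rule Max_in[OF finite_throttling_products throttling_products_nonempty[OF assms]])
  then show ?thesis
    using pd_throttling_mult_complement_le by (auto simp: throttling_products_def)
qed

text \<open>The edgeless graph contributes a factor of at least \<open>n\<close>, and the factor of
  its complement is positive.\<close>

lemma max_throttling_product_ge:
  assumes "n \<ge> 1"
  shows "n \<le> max_throttling_product n"
proof -
  define G :: "nat pair_pre_digraph" where "G = \<lparr> pverts = {..<n}, parcs = {} \<rparr>"
  have "symmetric (with_proj G)"
    by (auto simp: G_def symmetric_def arcs_ends_conv with_proj_def intro!: symI)
  then have "pair_graph G" by unfold_locales (auto simp: G_def)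
  then have G: "simple_graph G" and n: "order G = n"
    using assms by (auto simp: simple_graph_def order_def G_def lessThan_empty_iff)
  have "n \<le> pd_throttling G"
    using pd_throttling_edgeless[OF G] n by (simp add: G_def)
  moreover have "1 \<le> pd_throttling (complement G)"
  proof (rule pd_throttling_ge[OF simple_graph_complement[OF G]])
    fix B t assume "B \<subseteq> pverts (complement G)" "B \<noteq> {}"
    moreover have "finite (pverts (complement G))" by (simp add: complement_def G_def)
    ultimately have "card B > 0" by (auto simp: card_gt_0_iff finite_subset)
    then show "1 \<le> card B * (1 + t)" by simp
  qed
  ultimately have "n * 1 \<le> pd_throttling G * pd_throttling (complement G)"
    by (rule mult_le_mono)
  also have "\<dots> \<le> max_throttling_product n"
    unfolding max_throttling_product_def using G n
    by (intro Max_ge finite_throttling_products) (auto simp: throttling_products_def)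
  finally show ?thesis by simp
qed

theorem corollary4p12:
  shows "(\<forall>r::nat. r \<ge> 1 \<longrightarrow>
            (\<exists>G :: nat pair_pre_digraph. simple_graph G \<and> order G = 7 * r \<and>
               pd_throttling G * pd_throttling (complement G) = 24 * r \<and>
               real (24 * r) = 24 * real (order G) / 7))
         \<and> (\<lambda>n. real (max_throttling_product n)) \<in> \<Theta>(\<lambda>n. real n)"
proof
  show "\<forall>r::nat. r \<ge> 1 \<longrightarrow>
            (\<exists>G :: nat pair_pre_digraph. simple_graph G \<and> order G = 7 * r \<and>
               pd_throttling G * pd_throttling (complement G) = 24 * r \<and>
               real (24 * r) = 24 * real (order G) / 7)"
  proof (intro allI impI)
    fix r :: nat assume "r \<ge> 1"
    then show "\<exists>G :: nat pair_pre_digraph. simple_graph G \<and> order G = 7 * r \<and>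
               pd_throttling G * pd_throttling (complement G) = 24 * r \<and>
               real (24 * r) = 24 * real (order G) / 7"
      by (intro exI[of _ "triangle_squares r"])
        (simp add: simple_graph_triangle_squares pd_throttling_triangle_squares
          pd_throttling_complement_triangle_squares)
  qed
  \<comment> \<open>Both estimates start at \<open>n = 1\<close>: there is no graph of order 0, so
    the maximum there is \<open>Max {}\<close>, which is unspecified.\<close>
  have "(\<lambda>n. real (max_throttling_product n)) \<in> O(\<lambda>n. real n)"
  proof (rule bigoI[of _ 4])
    show "\<forall>\<^sub>F n in sequentially. norm (real (max_throttling_product n)) \<le> 4 * norm (real n)"
      using eventually_ge_at_top[of 1]
      by eventually_elim (use max_throttling_product_le in fastforce)
  qed
  moreover have "(\<lambda>n. real n) \<in> O(\<lambda>n. real (max_throttling_product n))"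
  proof (rule bigoI[of _ 1])
    show "\<forall>\<^sub>F n in sequentially. norm (real n) \<le> 1 * norm (real (max_throttling_product n))"
      using eventually_ge_at_top[of 1]
      by eventually_elim (use max_throttling_product_ge in fastforce)
  qed
  ultimately show "(\<lambda>n. real (max_throttling_product n)) \<in> \<Theta>(\<lambda>n. real n)"
    by (simp add: bigtheta_def bigomega_iff_bigo)
qed

end
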